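(* Let $\Omega\subseteq\mathbb{C}$ be a domain, let $T=\{T(\lambda):\lambda\in\Omega\}$ be a family of linear operators and $\mathbf{t}=\{\mathbf{t}(\lambda):\lambda\in\Omega\}$ a family of sesquilinear forms in a Hilbert space $\mathcal{H}$. Then, for every $\varepsilon>0$, $$W_\varepsilon(T)=\{\lambda\in\Omega:\exists\, f\in\operatorname{dom}T(\lambda),\ \|f\|=1,\ |(T(\lambda)f,f)|<\varepsilon\},$$ $$W_\varepsilon(\mathbf{t})=\{\lambda\in\Omega:\exists\, f\in\operatorname{dom}\mathbf{t}(\lambda),\ \|f\|=1,\ |\mathbf{t}(\lambda)[f]|<\varepsilon\},$$ and, consequently, $$W_\Psi(T)=\{\lambda\in\Omega:0\in\overline{W(T(\lambda))}\},\qquad W_\Psi(\mathbf{t})=\{\lambda\in\Omega:0\in\overline{W(\mathbf{t}(\lambda))}\}.$$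
   Context: $\mathcal{H}$ is a complex Hilbert space with inner product $(\cdot,\cdot)$, $L(\mathcal{H})$ is the space of bounded linear operators on $\mathcal{H}$. Each $T(\lambda)$ is a (bounded or unbounded) linear operator in $\mathcal{H}$ with domain $\operatorname{dom}T(\lambda)\subseteq\mathcal{H}$; each $\mathbf{t}(\lambda)$ is a (bounded or unbounded) sesquilinear form in $\mathcal{H}$ with domain $\operatorname{dom}\mathbf{t}(\lambda)\subseteq\mathcal H$, and $\mathbf{t}(\lambda)[f]:=\mathbf{t}(\lambda)[f,f]$. For a linear operator $A$ in $\mathcal H$, $W(A)=\{(Af,f):f\in\operatorname{dom}A,\|f\|=1\}$; for a form $\mathbf{a}$, $W(\mathbf{a})=\{\mathbf{a}[f]:f\in\operatorname{dom}\mathbf{a},\|f\|=1\}$. For families, $W(T)=\{\lambda\in\Omega:0\in W(T(\lambda))\}$ and $W(\mathbf{t})=\{\lambda\in\Omega:0\in W(\mathbf{t}(\lambda))\}$. For $\varepsilon>0$, $W_\varepsilon(T)=\bigcup_{B\in L(\mathcal{H}),\|B\|<\varepsilon}W(T+B)$, where $(T+B)(\lambda)=T(\lambda)+B$, and $W_\varepsilon(\mathbf{t})=\bigcup_{\|\mathbf{b}\|<\varepsilon}W(\mathbf{t}+\mathbf{b})$, the union being over bounded sesquilinear forms $\mathbf{b}$ on $\mathcal{H}$ with $\|\mathbf{b}\|=\sup_{\|f\|=\|g\|=1}|\mathbf{b}[f,g]|<\varepsilon$. The pseudo numerical ranges are $W_\Psi(T)=\bigcap_{\varepsilon>0}W_\varepsilon(T)$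 and $W_\Psi(\mathbf{t})=\bigcap_{\varepsilon>0}W_\varepsilon(\mathbf{t})$. *)

theory Defs
  imports "HOL-Analysis.Analysis"
begin

section \<open>Complex Hilbert spaces\<close>

class complex_vector = real_vector +
  fixes scaleC :: "complex \<Rightarrow> 'a \<Rightarrow> 'a"  (infixr \<open>*\<^sub>C\<close> 75)
  assumes scaleC_add_right: "c *\<^sub>C (x + y) = c *\<^sub>C x + c *\<^sub>C y"
    and scaleC_add_left: "(c + d) *\<^sub>C x = c *\<^sub>C x + d *\<^sub>C x"
    and scaleC_scaleC: "c *\<^sub>C d *\<^sub>C x = (c * d) *\<^sub>C x"
    and scaleR_scaleC: "r *\<^sub>R x = complex_of_real r *\<^sub>C x"

lemma scaleC_one: "1 *\<^sub>C (x::'a::complex_vector) = x"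
  using scaleR_scaleC[of 1 x] by simp

global_interpretation complex_vector: vector_space "scaleC :: complex \<Rightarrow> 'a \<Rightarrow> 'a::complex_vector"
  defines csubspace = complex_vector.subspace
  by unfold_locales (simp_all add: scaleC_add_right scaleC_add_left scaleC_scaleC scaleC_one)

text \<open>
  The inner product is linear in its first argument. Positive definiteness of \<open>cinner\<close> is
  contained in \<open>cinner_self\<close>, since \<open>norm\<close> is already a norm.
\<close>

class complex_inner = complex_vector + real_normed_vector +
  fixes cinner :: "'a \<Rightarrow> 'a \<Rightarrow> complex"
  assumes cinner_add_left: "cinner (x + y) z = cinner x z + cinner y z"
    and cinner_scaleC_left: "cinner (c *\<^sub>C x) y = c * cinner x y"
    and cinner_commute: "cinner x y = cnj (cinner y x)"
    and cinner_self: "cinner x x = complex_of_real ((norm x)\<^sup>2)"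

class complex_hilbert_space = complex_inner + complete_space

instantiation complex :: complex_hilbert_space
begin

definition scaleC_complex :: "complex \<Rightarrow> complex \<Rightarrow> complex"
  where "scaleC_complex c x = c * x"

definition cinner_complex :: "complex \<Rightarrow> complex \<Rightarrow> complex"
  where "cinner_complex x y = x * cnj y"

instance
  by standard
    (simp_all add: scaleC_complex_def cinner_complex_def algebra_simps scaleR_conv_of_real
      complex_norm_square del: of_real_power)

end


section \<open>Operators and forms with a domain\<close>

text \<open>
  The functions in these records are total, but only their values on the domain are ever used.
\<close>

record 'a operator =
  op_dom :: "'a set"
  op_fun :: "'a \<Rightarrow> 'a"

record 'a form =
  form_dom :: "'a set"
  form_fun :: "'a \<Rightarrow> 'a \<Rightarrow> complex"

definition linear_operator :: "'a::complex_vector operator \<Rightarrow> bool" where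
  "linear_operator A \<longleftrightarrow> csubspace (op_dom A) \<and>
    (\<forall>f\<in>op_dom A. \<forall>g\<in>op_dom A. op_fun A (f + g) = op_fun A f + op_fun A g) \<and>
    (\<forall>c. \<forall>f\<in>op_dom A. op_fun A (c *\<^sub>C f) = c *\<^sub>C op_fun A f)"

definition sesquilinear_form :: "'a::complex_vector form \<Rightarrow> bool" where
  "sesquilinear_form a \<longleftrightarrow> csubspace (form_dom a) \<and>
    (\<forall>f\<in>form_dom a. \<forall>g\<in>form_dom a. \<forall>h\<in>form_dom a.
      form_fun a (f + g) h = form_fun a f h + form_fun a g h \<and>
      form_fun a h (f + g) = form_fun a h f + form_fun a h g) \<and>
    (\<forall>c. \<forall>f\<in>form_dom a. \<forall>g\<in>form_dom a.
      form_fun a (c *\<^sub>C f) g = c * form_fun a f g \<and>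
      form_fun a f (c *\<^sub>C g) = cnj c * form_fun a f g)"

text \<open>The space \<open>L(H)\<close>; the operator norm is \<^const>\<open>onorm\<close>.\<close>

definition bounded_operators :: "('a::complex_inner \<Rightarrow> 'a) set" where
  "bounded_operators = {B. bounded_linear B \<and> (\<forall>c f. B (c *\<^sub>C f) = c *\<^sub>C B f)}"

definition bounded_forms :: "('a::complex_inner \<Rightarrow> 'a \<Rightarrow> complex) set" where
  "bounded_forms = {b. sesquilinear_form \<lparr>form_dom = UNIV, form_fun = b\<rparr> \<and>
    (\<exists>K. \<forall>f g. cmod (b f g) \<le> K * norm f * norm g)}"

text \<open>
  Inserting \<open>0\<close> only matters in the zero space, which has no unit vectors: the supremum of the empty
  set of real numbers is unspecified, whereas the norm should be \<open>0\<close>.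
\<close>

definition form_norm :: "('a::complex_inner \<Rightarrow> 'a \<Rightarrow> complex) \<Rightarrow> real" where
  "form_norm b = Sup (insert 0 {cmod (b f g) | f g. norm f = 1 \<and> norm g = 1})"

definition op_plus :: "'a::complex_vector operator \<Rightarrow> ('a \<Rightarrow> 'a) \<Rightarrow> 'a operator" where
  "op_plus A B = \<lparr>op_dom = op_dom A, op_fun = (\<lambda>f. op_fun A f + B f)\<rparr>"

definition form_plus :: "'a form \<Rightarrow> ('a \<Rightarrow> 'a \<Rightarrow> complex) \<Rightarrow> 'a form" where
  "form_plus a b = \<lparr>form_dom = form_dom a, form_fun = (\<lambda>f g. form_fun a f g + b f g)\<rparr>"


section \<open>Numerical ranges\<close>

definition op_num_range :: "'a::complex_inner operator \<Rightarrow> complex set" where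
  "op_num_range A = {cinner (op_fun A f) f | f. f \<in> op_dom A \<and> norm f = 1}"

definition form_num_range :: "'a::complex_inner form \<Rightarrow> complex set" where
  "form_num_range a = {form_fun a f f | f. f \<in> form_dom a \<and> norm f = 1}"

definition op_family_num_range ::
  "complex set \<Rightarrow> (complex \<Rightarrow> 'a::complex_inner operator) \<Rightarrow> complex set" where
  "op_family_num_range \<Omega> T = {z \<in> \<Omega>. 0 \<in> op_num_range (T z)}"

definition form_family_num_range ::
  "complex set \<Rightarrow> (complex \<Rightarrow> 'a::complex_inner form) \<Rightarrow> complex set" where
  "form_family_num_range \<Omega> t = {z \<in> \<Omega>. 0 \<in> form_num_range (t z)}"

definition op_eps_num_range ::
  "complex set \<Rightarrow> real \<Rightarrow> (complex \<Rightarrow> 'a::complex_inner operator) \<Rightarrow> complex set" where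
  "op_eps_num_range \<Omega> \<epsilon> T =
    (\<Union>B\<in>{B \<in> bounded_operators. onorm B < \<epsilon>}. op_family_num_range \<Omega> (\<lambda>z. op_plus (T z) B))"

definition form_eps_num_range ::
  "complex set \<Rightarrow> real \<Rightarrow> (complex \<Rightarrow> 'a::complex_inner form) \<Rightarrow> complex set" where
  "form_eps_num_range \<Omega> \<epsilon> t =
    (\<Union>b\<in>{b \<in> bounded_forms. form_norm b < \<epsilon>}. form_family_num_range \<Omega> (\<lambda>z. form_plus (t z) b))"

definition op_pseudo_num_range ::
  "complex set \<Rightarrow> (complex \<Rightarrow> 'a::complex_inner operator) \<Rightarrow> complex set" where
  "op_pseudo_num_range \<Omega> T = (\<Inter>\<epsilon>\<in>{0<..}. op_eps_num_range \<Omega> \<epsilon> T)"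

definition form_pseudo_num_range ::
  "complex set \<Rightarrow> (complex \<Rightarrow> 'a::complex_inner form) \<Rightarrow> complex set" where
  "form_pseudo_num_range \<Omega> t = (\<Inter>\<epsilon>\<in>{0<..}. form_eps_num_range \<Omega> \<epsilon> t)"

end

theory Submission
  imports Defs
begin

text \<open>
  A perturbation of norm below \<open>\<epsilon>\<close> changes a value of the form at a unit vector by less than \<open>\<epsilon>\<close>
  (Cauchy--Schwarz). Conversely, if \<open>f\<close> is a unit vector at which the value \<open>w\<close> satisfies
  \<open>\<bar>w\<bar> < \<epsilon>\<close>, then subtracting the multiple \<open>w\<close> of the identity (respectively of the inner product)
  is a perturbation of norm below \<open>\<epsilon>\<close> that makes the value at \<open>f\<close> vanish.
\<close>

lemma cinner_add_right: "cinner x (y + z) = cinner x y + cinner x (z::'a::complex_inner)"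
  by (metis cinner_add_left cinner_commute complex_cnj_add)

lemma cinner_scaleC_right: "cinner x (c *\<^sub>C y) = cnj c * cinner x (y::'a::complex_inner)"
  by (metis cinner_commute cinner_scaleC_left complex_cnj_mult)

text \<open>The class axioms tie the norm directly to real scalars only; complex homogeneity comes
  from \<open>cinner_self\<close>, comparing squares of nonnegative reals.\<close>

lemma norm_scaleC: "norm (c *\<^sub>C x) = cmod c * norm (x::'a::complex_inner)"
proof -
  have "complex_of_real ((norm (c *\<^sub>C x))\<^sup>2) = (c * cnj c) * complex_of_real ((norm x)\<^sup>2)"
    by (simp only: cinner_self[symmetric] cinner_scaleC_left cinner_scaleC_right mult_ac)
  also have "\<dots> = complex_of_real ((cmod c * norm x)\<^sup>2)"
    by (simp only: complex_norm_square[symmetric] of_real_mult[symmetric] power_mult_distrib)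
  finally have "(norm (c *\<^sub>C x))\<^sup>2 = (cmod c * norm x)\<^sup>2"
    by (simp only: of_real_eq_iff)
  then show ?thesis
    by (simp add: power2_eq_iff_nonneg)
qed

text \<open>Cauchy-Schwarz: the squared norm of a vector orthogonal to \<open>y\<close> is
  nonnegative.\<close>

lemma norm_cinner_le: "cmod (cinner x y) \<le> norm x * norm (y::'a::complex_inner)"
proof (cases "y = 0")
  case True
  have "cinner x 0 = cinner x 0 + cinner x 0"
    using cinner_add_right[of x 0 0] by simp
  with True show ?thesis by simp
next
  case False
  define c where "c = cinner x y"
  define s where "s = (norm y)\<^sup>2"
  \<comment> \<open>This is \<open>s\<close> times the component of \<open>x\<close> orthogonal to
    \<open>y\<close>; the factor \<open>s\<close> avoids dividing by the squared norm of
    \<open>y\<close>.\<close>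
  define v where "v = complex_of_real s *\<^sub>C x + (- c) *\<^sub>C y"
  have yx: "cinner y x = cnj c"
    unfolding c_def by (rule cinner_commute)
  have "cinner v v = complex_of_real s * (complex_of_real s * complex_of_real ((norm x)\<^sup>2) - c * cnj c)"
    unfolding v_def cinner_add_left cinner_add_right cinner_scaleC_left cinner_scaleC_right
    by (simp add: cinner_self yx c_def[symmetric] s_def[symmetric] algebra_simps
        del: of_real_power)
  then have "complex_of_real ((norm v)\<^sup>2) = complex_of_real (s * (s * (norm x)\<^sup>2 - (cmod c)\<^sup>2))"
    by (simp only: cinner_self complex_norm_square[symmetric] of_real_mult of_real_diff)
  then have "s * (s * (norm x)\<^sup>2 - (cmod c)\<^sup>2) \<ge> 0"
    by (metis of_real_eq_iff zero_le_power2)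
  moreover have "s > 0"
    using False by (simp add: s_def)
  \<comment> \<open>Cancelling the positive factor \<open>s\<close> leaves the squared inequality,
    because the inner \<open>s\<close> is again the squared norm of \<open>y\<close>.\<close>
  ultimately have "(cmod c)\<^sup>2 \<le> (norm x * norm y)\<^sup>2"
    by (simp add: zero_le_mult_iff s_def power_mult_distrib mult.commute)
  then show ?thesis
    unfolding c_def by (rule power2_le_imp_le) simp
qed

lemma scaleC_bounded_operator: "scaleC c \<in> (bounded_operators :: ('a::complex_inner \<Rightarrow> 'a) set)"
proof -
  have "bounded_linear (scaleC c :: 'a \<Rightarrow> 'a)"
    by (rule bounded_linear_intro[where K = "cmod c"])
      (simp_all add: scaleC_add_right scaleR_scaleC scaleC_scaleC norm_scaleC mult.commute)
  then show ?thesis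
    by (simp add: bounded_operators_def scaleC_scaleC mult.commute)
qed

text \<open>Equality can fail: in the zero space the operator norm is 0 for every \<open>c\<close>.
  The upper bound suffices for constructing small perturbations.\<close>

lemma onorm_scaleC_le: "onorm (scaleC c :: 'a::complex_inner \<Rightarrow> 'a) \<le> cmod c"
  by (rule onorm_bound) (simp_all add: norm_scaleC)

lemma scaled_cinner_bounded_form:
  "(\<lambda>f g. c * cinner f g) \<in> (bounded_forms :: ('a::complex_inner \<Rightarrow> 'a \<Rightarrow> complex) set)"
proof -
  have "cmod (c * cinner f g) \<le> cmod c * norm f * norm g" for f g :: 'a
    using mult_left_mono[OF norm_cinner_le[of f g], of "cmod c"] by (simp add: norm_mult mult.assoc)
  then have "\<exists>K. \<forall>f g::'a. cmod (c * cinner f g) \<le> K * norm f * norm g"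
    by blast
  then show ?thesis
    by (simp add: bounded_forms_def sesquilinear_form_def cinner_add_left cinner_add_right
        cinner_scaleC_left cinner_scaleC_right algebra_simps)
qed

lemma form_norm_scaled_cinner_le:
  "form_norm (\<lambda>f g::'a::complex_inner. c * cinner f g) \<le> cmod c"
  unfolding form_norm_def
proof (rule cSup_least)
  fix r
  assume "r \<in> insert 0 {cmod (c * cinner f g) | f g::'a. norm f = 1 \<and> norm g = 1}"
  \<comment> \<open>The inserted 0 keeps the set nonempty even in the zero space, as
    \<open>cSup_least\<close> demands, and forms a case of its own.\<close>
  then consider "r = 0" | f g :: 'a where "r = cmod c * cmod (cinner f g)" "norm f = 1" "norm g = 1"
    by (auto simp: norm_mult)
  then show "r \<le> cmod c"
  proof cases
    case 2
    then show ?thesis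
      using norm_cinner_le[of f g] by (simp add: mult_left_le)
  qed simp
qed simp

text \<open>A real supremum dominates its set only if the set is bounded above; the constant
  \<open>K\<close> from the boundedness of \<open>b\<close> is such a bound, since unit vectors
  reduce the estimate to \<open>K\<close>.\<close>

lemma cmod_le_form_norm:
  assumes "b \<in> bounded_forms" "norm f = 1" "norm g = 1"
  shows "cmod (b f g) \<le> form_norm b"
proof -
  obtain K where K: "\<And>f g. cmod (b f g) \<le> K * norm f * norm g"
    using assms(1) by (auto simp: bounded_forms_def)
  have "bdd_above {cmod (b f g) | f g. norm f = 1 \<and> norm g = 1}"
  proof (rule bdd_aboveI)
    fix r
    assume "r \<in> {cmod (b f g) | f g. norm f = 1 \<and> norm g = 1}"
    then obtain f g where "r = cmod (b f g)" "norm f = 1" "norm g = 1"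
      by blast
    then show "r \<le> K"
      using K[of f g] by simp
  qed
  then show ?thesis
    unfolding form_norm_def using assms(2,3) by (intro cSup_upper) auto
qed

lemma cmod_cinner_le_onorm:
  assumes "bounded_linear B" "norm (f::'a::complex_inner) = 1"
  shows "cmod (cinner (B f) f) \<le> onorm B"
  using norm_cinner_le[of "B f" f] onorm[OF assms(1), of f] assms(2) by simp

lemma op_eps_num_range_eq:
  "op_eps_num_range \<Omega> \<epsilon> T =
    {z \<in> \<Omega>. \<exists>f\<in>op_dom (T z). norm f = 1 \<and> cmod (cinner (op_fun (T z) f) f) < \<epsilon>}"
  (is "?L = ?R")
proof
  show "?L \<subseteq> ?R"
  proof
    fix z
    assume "z \<in> ?L"
    then obtain B f where B: "bounded_linear B" "onorm B < \<epsilon>" and "z \<in> \<Omega>"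
      and f: "f \<in> op_dom (T z)" "norm f = 1"
      and zero: "cinner (op_fun (T z) f + B f) f = 0"
      by (auto simp: op_eps_num_range_def op_family_num_range_def op_num_range_def op_plus_def
          bounded_operators_def)
    have "cmod (cinner (op_fun (T z) f) f) = cmod (cinner (B f) f)"
      using zero by (simp add: cinner_add_left eq_neg_iff_add_eq_0[symmetric])
    also have "\<dots> < \<epsilon>"
      using cmod_cinner_le_onorm[OF B(1) f(2)] B(2) by simp
    finally show "z \<in> ?R"
      using \<open>z \<in> \<Omega>\<close> f by blast
  qed
next
  show "?R \<subseteq> ?L"
  proof
    fix z
    assume "z \<in> ?R"
    then obtain f where z: "z \<in> \<Omega>" and f: "f \<in> op_dom (T z)" "norm f = 1"
      and less: "cmod (cinner (op_fun (T z) f) f) < \<epsilon>"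
      by blast
    \<comment> \<open>The choice depends on \<open>z\<close>, which is harmless: membership of
      \<open>z\<close> in the union asks for one perturbation that works at this point, and the same
      operator is then added throughout the family.\<close>
    define w where "w = cinner (op_fun (T z) f) f"
    have "cinner (op_fun (T z) f + (- w) *\<^sub>C f) f = 0"
      unfolding cinner_add_left cinner_scaleC_left cinner_self by (simp add: f(2) w_def)
    then have "z \<in> op_family_num_range \<Omega> (\<lambda>z. op_plus (T z) (scaleC (- w)))"
      using z f by (force simp: op_family_num_range_def op_num_range_def op_plus_def)
    moreover have "onorm (scaleC (- w) :: 'a \<Rightarrow> 'a) < \<epsilon>"
      using onorm_scaleC_le[of "- w"] less unfolding w_def norm_minus_cancel
      by (rule le_less_trans)
    ultimately show "z \<in> ?L"
      using scaleC_bounded_operator unfolding op_eps_num_range_def by blast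
  qed
qed

lemma form_eps_num_range_eq:
  "form_eps_num_range \<Omega> \<epsilon> t =
    {z \<in> \<Omega>. \<exists>f\<in>form_dom (t z). norm f = 1 \<and> cmod (form_fun (t z) f f) < \<epsilon>}"
  (is "?L = ?R")
proof
  show "?L \<subseteq> ?R"
  proof
    fix z
    assume "z \<in> ?L"
    then obtain b f where b: "b \<in> bounded_forms" "form_norm b < \<epsilon>" and "z \<in> \<Omega>"
      and f: "f \<in> form_dom (t z)" "norm f = 1"
      and zero: "form_fun (t z) f f + b f f = 0"
      by (auto simp: form_eps_num_range_def form_family_num_range_def form_num_range_def
          form_plus_def)
    have "cmod (form_fun (t z) f f) = cmod (b f f)"
      using zero by (simp add: eq_neg_iff_add_eq_0[symmetric])
    also have "\<dots> < \<epsilon>"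
      using cmod_le_form_norm[OF b(1) f(2) f(2)] b(2) by simp
    finally show "z \<in> ?R"
      using \<open>z \<in> \<Omega>\<close> f by blast
  qed
next
  show "?R \<subseteq> ?L"
  proof
    fix z
    assume "z \<in> ?R"
    then obtain f where z: "z \<in> \<Omega>" and f: "f \<in> form_dom (t z)" "norm f = 1"
      and less: "cmod (form_fun (t z) f f) < \<epsilon>"
      by blast
    define w where "w = form_fun (t z) f f"
    \<comment> \<open>This is the form induced by the operator \<open>- w\<close> times the
      identity. At the unit vector \<open>f\<close> it takes the value \<open>- w\<close>; bounding
      it at all pairs of unit vectors takes Cauchy-Schwarz.\<close>
    define b :: "'a \<Rightarrow> 'a \<Rightarrow> complex" where "b = (\<lambda>f g. - w * cinner f g)"
    have "form_fun (t z) f f + b f f = 0"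
      unfolding b_def cinner_self by (simp add: f(2) w_def)
    then have "z \<in> form_family_num_range \<Omega> (\<lambda>z. form_plus (t z) b)"
      using z f by (force simp: form_family_num_range_def form_num_range_def form_plus_def)
    moreover have "form_norm b < \<epsilon>"
      using form_norm_scaled_cinner_le[of "- w"] less unfolding b_def w_def norm_minus_cancel
      by (rule le_less_trans)
    moreover have "b \<in> bounded_forms"
      unfolding b_def by (rule scaled_cinner_bounded_form)
    ultimately show "z \<in> ?L"
      unfolding form_eps_num_range_def by blast
  qed
qed

text \<open>Zero lies in the closure exactly when the range has elements of arbitrarily small
  modulus, which is what intersecting the previous description over all positive \<epsilon>
  expresses.\<close>

lemma op_pseudo_num_range_eq:
  "op_pseudo_num_range \<Omega> T = {z \<in> \<Omega>. 0 \<in> closure (op_num_range (T z))}"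
proof -
  have "0 \<in> closure (op_num_range (T z)) \<longleftrightarrow>
      (\<forall>\<epsilon>>0. \<exists>f\<in>op_dom (T z). norm f = 1 \<and> cmod (cinner (op_fun (T z) f) f) < \<epsilon>)" for z
    unfolding closure_approachable op_num_range_def by fastforce
  then show ?thesis
    \<comment> \<open>Membership in \<Omega> has to be read off from one member of the intersection;
      \<open>zero_less_one\<close> supplies \<epsilon> = 1.\<close>
    unfolding op_pseudo_num_range_def op_eps_num_range_eq by (auto intro: zero_less_one)
qed

lemma form_pseudo_num_range_eq:
  "form_pseudo_num_range \<Omega> t = {z \<in> \<Omega>. 0 \<in> closure (form_num_range (t z))}"
proof -
  have "0 \<in> closure (form_num_range (t z)) \<longleftrightarrow>
      (\<forall>\<epsilon>>0. \<exists>f\<in>form_dom (t z). norm f = 1 \<and> cmod (form_fun (t z) f f) < \<epsilon>)" for z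
    unfolding closure_approachable form_num_range_def by fastforce
  then show ?thesis
    unfolding form_pseudo_num_range_def form_eps_num_range_eq by (auto intro: zero_less_one)
qed

theorem proposition2p3:
  fixes \<Omega> :: "complex set"
    and T :: "complex \<Rightarrow> 'a::complex_hilbert_space operator"
    and t :: "complex \<Rightarrow> 'a form"
  assumes "open \<Omega>" and "connected \<Omega>" and "\<Omega> \<noteq> {}"
    and "\<And>z. z \<in> \<Omega> \<Longrightarrow> linear_operator (T z)"
    and "\<And>z. z \<in> \<Omega> \<Longrightarrow> sesquilinear_form (t z)"
  shows "(\<forall>\<epsilon>>0.
      op_eps_num_range \<Omega> \<epsilon> T =
        {z \<in> \<Omega>. \<exists>f\<in>op_dom (T z). norm f = 1 \<and> cmod (cinner (op_fun (T z) f) f) < \<epsilon>} \<and>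
      form_eps_num_range \<Omega> \<epsilon> t =
        {z \<in> \<Omega>. \<exists>f\<in>form_dom (t z). norm f = 1 \<and> cmod (form_fun (t z) f f) < \<epsilon>}) \<and>
    op_pseudo_num_range \<Omega> T = {z \<in> \<Omega>. 0 \<in> closure (op_num_range (T z))} \<and>
    form_pseudo_num_range \<Omega> t = {z \<in> \<Omega>. 0 \<in> closure (form_num_range (t z))}"
  by (simp only: op_eps_num_range_eq form_eps_num_range_eq op_pseudo_num_range_eq
      form_pseudo_num_range_eq simp_thms)

end
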